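(* Let $p>1$, $\frac1p+\frac1q=1$, $\alpha>0$, $\beta\in(0,1]$, $x>1$, and let $f,g$ be two positive functions on $[1,\infty)$ such that $\mathcal{H}^{\alpha,\beta}_{1,x}[f(x)]<\infty$ and $\mathcal{H}^{\alpha,\beta}_{1,x}[g(x)]<\infty$. If $m,M$ are real constants such that $0<m\le\frac{f(\tau)}{g(\tau)}\le M<\infty$ for all $\tau\in(1,x)$, then $$\left[\mathcal{H}^{\alpha,\beta}_{1,x}[f(x)]\right]^{\frac1p}\left[\mathcal{H}^{\alpha,\beta}_{1,x}[g(x)]\right]^{\frac1q}\le\left(\frac{M}{m}\right)^{\frac{1}{pq}}\mathcal{H}^{\alpha,\beta}_{1,x}\left[[f(x)]^{\frac1p}[g(x)]^{\frac1q}\right].$$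
   Context: For $\alpha>0$, $\beta\in(0,1]$ and $x>1$, the one-sided generalized proportional Hadamard fractional integral of a (measurable) function $z$ on $[1,\infty)$ is $$\mathcal{H}^{\alpha,\beta}_{1,x}[z(x)]=(\mathcal{H}^{\alpha,\beta}_{1,x}z)(x)=\frac{1}{\beta^{\alpha}\Gamma(\alpha)}\int_{1}^{x}e^{\frac{\beta-1}{\beta}(\ln x-\ln t)}(\ln x-\ln t)^{\alpha-1}\frac{z(t)}{t}\,dt,$$ where $\Gamma$ is the gamma function. Functions are real-valued and measurable. *)

theory Defs
  imports "HOL-Analysis.Analysis"
begin

definition prop_hadamard_integrand ::
  "real \<Rightarrow> real \<Rightarrow> (real \<Rightarrow> real) \<Rightarrow> real \<Rightarrow> real \<Rightarrow> real" where
  "prop_hadamard_integrand \<alpha> \<beta> z x t =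
     exp ((\<beta> - 1) / \<beta> * (ln x - ln t)) * (ln x - ln t) powr (\<alpha> - 1) * (z t / t)"

text \<open>
  The one-sided generalized proportional Hadamard fractional integral with base point 1,
  meant for \<open>\<alpha> > 0\<close>, \<open>0 < \<beta> \<le> 1\<close> and \<open>x > 1\<close>.
\<close>
definition prop_hadamard ::
  "real \<Rightarrow> real \<Rightarrow> (real \<Rightarrow> real) \<Rightarrow> real \<Rightarrow> real" where
  "prop_hadamard \<alpha> \<beta> z x =
     1 / (\<beta> powr \<alpha> * Gamma \<alpha>) *
     integral\<^sup>L (lebesgue_on {1..x}) (prop_hadamard_integrand \<alpha> \<beta> z x)"

text \<open>
  The Bochner integral of a non-integrable function is 0 by convention, so finiteness of
  \<open>prop_hadamard \<alpha> \<beta> z x\<close> is a predicate of its own.  For measurable \<open>z \<ge> 0\<close> it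
  says that the integral, as an element of \<open>[0, \<infinity>]\<close>, is less than \<open>\<infinity>\<close>.
\<close>
definition prop_hadamard_finite ::
  "real \<Rightarrow> real \<Rightarrow> (real \<Rightarrow> real) \<Rightarrow> real \<Rightarrow> bool" where
  "prop_hadamard_finite \<alpha> \<beta> z x \<longleftrightarrow>
     integrable (lebesgue_on {1..x}) (prop_hadamard_integrand \<alpha> \<beta> z x)"

end

theory Submission
  imports Defs
begin

text \<open>
  The inequality is a reverse Hoelder inequality, and it holds on any measure space. Write
  \<open>a = 1/p\<close>, \<open>b = 1/q\<close>, so that \<open>a + b = 1\<close>. If
  \<open>u, v \<ge> 0\<close> and \<open>m v \<le> u \<le> C v\<close>, the weighted geometric mean
  \<open>u\<^sup>a v\<^sup>b\<close> dominates both functions up to constants,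
  \<open>u = u\<^sup>a u\<^sup>b \<le> C\<^sup>b u\<^sup>a v\<^sup>b\<close> and \<open>m\<^sup>a v = (m v)\<^sup>a v\<^sup>b \<le> u\<^sup>a v\<^sup>b\<close>.
  Integrating both bounds, raising them to the powers \<open>a\<close> and \<open>b\<close> and multiplying recovers the
  first power of \<open>\<integral> u\<^sup>a v\<^sup>b\<close> with the constant \<open>(C / m)\<^sup>a\<^sup>b\<close>; this is
  \<open>reverse_Hoelder_ratio_bounds\<close>.

  For the fractional integral, \<open>u\<close> and \<open>v\<close> are the integrands of \<open>f\<close> and \<open>g\<close> including the
  nonnegative kernel and the normalising constant. Multiplying both functions by the same nonnegative
  factor keeps the ratio bounds, and \<open>a + b = 1\<close> makes the geometric mean homogeneous of degree
  one, so that \<open>u\<^sup>a v\<^sup>b\<close> is the integrand of \<open>f\<^sup>a g\<^sup>b\<close>.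
\<close>

lemma powr_mult_powr_sum_1:
  fixes w a b :: real
  assumes "0 \<le> w" "a + b = 1"
  shows "w powr a * w powr b = w"
  using assms by (simp flip: powr_add)

lemma weighted_geometric_mean_homogeneous:
  fixes c y z a b :: real
  assumes "0 \<le> c" "0 \<le> y" "0 \<le> z" "a + b = 1"
  shows "(c * y) powr a * (c * z) powr b = c * (y powr a * z powr b)"
proof -
  have "(c * y) powr a * (c * z) powr b = (c powr a * c powr b) * (y powr a * z powr b)"
    using assms by (simp add: powr_mult)
  then show ?thesis
    using assms by (simp add: powr_mult_powr_sum_1)
qed

text \<open>
  The converse of Hoelder's inequality fails in general because \<open>u\<close> and \<open>v\<close> may live on disjoint
  sets; the lower ratio bound excludes this for \<open>v\<close> and the upper one for \<open>u\<close>, since each makes the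
  geometric mean at least a positive multiple of that function.
\<close>
lemma reverse_Hoelder_ratio_bounds:
  fixes u v :: "'a \<Rightarrow> real" and a b m C :: real
  assumes ab: "0 < a" "0 < b" "a + b = 1" and mC: "0 < m" "0 < C"
    and u: "integrable N u" and v: "integrable N v"
    and u0: "AE t in N. 0 \<le> u t" and v0: "AE t in N. 0 \<le> v t"
    and lower: "AE t in N. m * v t \<le> u t" and upper: "AE t in N. u t \<le> C * v t"
  shows "(\<integral>t. u t \<partial>N) powr a * (\<integral>t. v t \<partial>N) powr b
    \<le> (C / m) powr (a * b) * (\<integral>t. u t powr a * v t powr b \<partial>N)"
proof -
  define w where "w t = u t powr a * v t powr b" for t
  define W where "W = (\<integral>t. w t \<partial>N)"
  have [measurable]: "u \<in> borel_measurable N" "v \<in> borel_measurable N"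
    using u v by auto
  have w_meas: "w \<in> borel_measurable N"
    unfolding w_def[abs_def] by measurable
  \<comment> \<open>The mean needs an integrable majorant: without integrability its Bochner integral would be 0
    and the two lower bounds on the mean could not be integrated.\<close>
  have w_le: "AE t in N. w t \<le> C powr a * v t"
    using u0 v0 upper
  proof eventually_elim
    case (elim t)
    have "w t \<le> (C * v t) powr a * v t powr b"
      unfolding w_def using elim ab by (intro mult_right_mono powr_mono2) auto
    also have "\<dots> = C powr a * (v t powr a * v t powr b)"
      using elim mC by (simp add: powr_mult)
    finally show ?case
      using elim ab by (simp add: powr_mult_powr_sum_1)
  qed
  have w: "integrable N w"
  proof (rule Bochner_Integration.integrable_bound)
    show "integrable N (\<lambda>t. C powr a * v t)"
      using v by simp
    show "AE t in N. norm (w t) \<le> norm (C powr a * v t)"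
      using w_le v0 by eventually_elim (simp add: w_def)
  qed (fact w_meas)
  have u_le: "AE t in N. u t \<le> C powr b * w t"
    using u0 v0 upper
  proof eventually_elim
    case (elim t)
    have "u t = u t powr a * u t powr b"
      using elim ab by (simp add: powr_mult_powr_sum_1)
    also have "\<dots> \<le> u t powr a * (C * v t) powr b"
      using elim ab by (intro mult_left_mono powr_mono2) auto
    also have "\<dots> = C powr b * w t"
      using elim mC by (simp add: powr_mult w_def)
    finally show ?case .
  qed
  have v_le: "AE t in N. v t \<le> m powr (- a) * w t"
    using u0 v0 lower
  proof eventually_elim
    case (elim t)
    have "m powr a * v t = m powr a * (v t powr a * v t powr b)"
      using elim ab by (simp add: powr_mult_powr_sum_1)
    also have "\<dots> = (m * v t) powr a * v t powr b"
      using elim mC by (simp add: powr_mult)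
    also have "\<dots> \<le> w t"
      unfolding w_def using elim ab mC by (intro mult_right_mono powr_mono2) auto
    finally show ?case
      using mC by (simp add: powr_minus field_simps)
  qed
  have W0: "0 \<le> W"
    unfolding W_def w_def by (rule integral_nonneg_AE) simp
  have U: "(\<integral>t. u t \<partial>N) \<le> C powr b * W"
    using integral_mono_AE[OF u _ u_le] w by (simp add: W_def)
  have V: "(\<integral>t. v t \<partial>N) \<le> m powr (- a) * W"
    using integral_mono_AE[OF v _ v_le] w by (simp add: W_def)
  have "(\<integral>t. u t \<partial>N) powr a * (\<integral>t. v t \<partial>N) powr b
      \<le> (C powr b * W) powr a * (m powr (- a) * W) powr b"
    using U V ab integral_nonneg_AE[OF u0] integral_nonneg_AE[OF v0]
    by (intro mult_mono powr_mono2) auto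
  also have "\<dots> = (C powr (a * b) * m powr (- (a * b))) * (W powr a * W powr b)"
    using W0 by (simp add: powr_mult powr_powr mult.commute mult.left_commute)
  also have "\<dots> = (C / m) powr (a * b) * W"
    using W0 ab mC by (simp add: powr_mult_powr_sum_1 powr_divide powr_minus_divide)
  finally show ?thesis
    by (simp add: W_def w_def)
qed

text \<open>
  Absorbing the normalising constant into the kernel presents \<open>prop_hadamard\<close> as one integral
  against a single weight, to which the reverse Hoelder inequality applies directly.
\<close>
definition prop_hadamard_weight :: "real \<Rightarrow> real \<Rightarrow> real \<Rightarrow> real \<Rightarrow> real" where
  "prop_hadamard_weight \<alpha> \<beta> x t = 1 / (\<beta> powr \<alpha> * Gamma \<alpha>) *
     (exp ((\<beta> - 1) / \<beta> * (ln x - ln t)) * (ln x - ln t) powr (\<alpha> - 1) / t)"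

lemma prop_hadamard_weight_integrand:
  "prop_hadamard_weight \<alpha> \<beta> x t * z t
    = 1 / (\<beta> powr \<alpha> * Gamma \<alpha>) * prop_hadamard_integrand \<alpha> \<beta> z x t"
  by (simp add: prop_hadamard_weight_def prop_hadamard_integrand_def)

lemma prop_hadamard_eq_weighted_integral:
  "prop_hadamard \<alpha> \<beta> z x
    = (\<integral>t. prop_hadamard_weight \<alpha> \<beta> x t * z t \<partial>lebesgue_on {1..x})"
  by (simp only: prop_hadamard_weight_integrand prop_hadamard_def
      Bochner_Integration.integral_mult_right_zero)

lemma integrable_prop_hadamard_weight:
  assumes "prop_hadamard_finite \<alpha> \<beta> z x"
  shows "integrable (lebesgue_on {1..x}) (\<lambda>t. prop_hadamard_weight \<alpha> \<beta> x t * z t)"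
  using assms unfolding prop_hadamard_weight_integrand prop_hadamard_finite_def
  by (rule Bochner_Integration.integrable_mult_right)

lemma prop_hadamard_weight_nonneg:
  assumes "0 < \<alpha>" "0 < t"
  shows "0 \<le> prop_hadamard_weight \<alpha> \<beta> x t"
  using assms Gamma_real_pos[of \<alpha>] by (simp add: prop_hadamard_weight_def)

lemma AE_lebesgue_on_Icc_interior:
  fixes l r :: real
  shows "AE t in lebesgue_on {l..r}. t \<in> {l<..<r}"
proof -
  have "AE t in lebesgue. t \<notin> {l, r}"
    by (rule AE_not_in) (simp add: negligible_iff_null_sets[symmetric])
  then have "AE t in lebesgue. t \<in> {l..r} \<longrightarrow> t \<in> {l<..<r}"
    by eventually_elim auto
  then show ?thesis
    by (subst AE_restrict_space_iff) (simp, fast)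
qed

theorem theorem4p1:
  fixes p q \<alpha> \<beta> x m M :: real and f g :: "real \<Rightarrow> real"
  assumes "p > 1" and "1 / p + 1 / q = 1"
    and "\<alpha> > 0" and "0 < \<beta>" and "\<beta> \<le> 1" and "x > 1"
    and "f \<in> borel_measurable (lebesgue_on {1..})"
    and "g \<in> borel_measurable (lebesgue_on {1..})"
    and "\<And>t. t \<ge> 1 \<Longrightarrow> f t > 0" and "\<And>t. t \<ge> 1 \<Longrightarrow> g t > 0"
    and "prop_hadamard_finite \<alpha> \<beta> f x" and "prop_hadamard_finite \<alpha> \<beta> g x"
    and "0 < m"
    and "\<And>\<tau>. \<tau> \<in> {1<..<x} \<Longrightarrow> m \<le> f \<tau> / g \<tau> \<and> f \<tau> / g \<tau> \<le> M"
  shows "prop_hadamard \<alpha> \<beta> f x powr (1 / p) * prop_hadamard \<alpha> \<beta> g x powr (1 / q)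
    \<le> (M / m) powr (1 / (p * q)) *
       prop_hadamard \<alpha> \<beta> (\<lambda>t. f t powr (1 / p) * g t powr (1 / q)) x"
proof -
  define a b where "a = 1 / p" and "b = 1 / q"
  define k where "k = prop_hadamard_weight \<alpha> \<beta> x"
  define L where "L = lebesgue_on {1..x}"
  define h where "h t = f t powr a * g t powr b" for t
  have "a < 1"
    using assms(1) by (simp add: a_def)
  moreover have "a + b = 1"
    using assms(2) by (simp add: a_def b_def)
  moreover have "0 < a"
    using assms(1) by (simp add: a_def)
  ultimately have ab: "0 < a" "0 < b" "a + b = 1"
    by linarith+
  \<comment> \<open>The midpoint only serves to make the ratio bounds nonvacuous.\<close>
  have "m \<le> M"
    using assms(14)[of "(1 + x) / 2"] \<open>x > 1\<close> by auto
  then have mM: "0 < m" "0 < M"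
    using \<open>0 < m\<close> by auto
  have k0: "0 \<le> k t" if "1 \<le> t" for t
    unfolding k_def using that \<open>\<alpha> > 0\<close> by (intro prop_hadamard_weight_nonneg) auto
  \<comment> \<open>The ratio bounds are given on the open interval only, hence almost everywhere.\<close>
  have interior: "AE t in L. t \<in> {1<..<x}"
    unfolding L_def by (rule AE_lebesgue_on_Icc_interior)
  have pos: "AE t in L. 0 \<le> k t * f t" "AE t in L. 0 \<le> k t * g t"
    using interior by (eventually_elim, use k0 assms(9,10) in \<open>simp add: less_imp_le\<close>)+
  have lower: "AE t in L. m * (k t * g t) \<le> k t * f t"
    using interior
  proof eventually_elim
    case (elim t)
    then have "m * g t \<le> f t"
      using assms(14)[of t] assms(10)[of t] by (simp add: field_simps)
    then show ?case
      using mult_left_mono[OF _ k0[of t]] elim by (simp add: mult.left_commute[of m])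
  qed
  have upper: "AE t in L. k t * f t \<le> M * (k t * g t)"
    using interior
  proof eventually_elim
    case (elim t)
    then have "f t \<le> M * g t"
      using assms(14)[of t] assms(10)[of t] by (simp add: field_simps)
    then show ?case
      using mult_left_mono[OF _ k0[of t]] elim by (simp add: mult.left_commute[of M])
  qed
  have mean: "(\<integral>t. (k t * f t) powr a * (k t * g t) powr b \<partial>L) = (\<integral>t. k t * h t \<partial>L)"
  proof (rule Bochner_Integration.integral_cong[OF refl])
    fix t assume "t \<in> space L"
    then have "1 \<le> t"
      by (simp add: L_def)
    then show "(k t * f t) powr a * (k t * g t) powr b = k t * h t"
      unfolding h_def using k0 assms(9,10) ab
      by (intro weighted_geometric_mean_homogeneous) (auto simp: less_imp_le)
  qed
  have "(\<integral>t. k t * f t \<partial>L) powr a * (\<integral>t. k t * g t \<partial>L) powr b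
      \<le> (M / m) powr (a * b) * (\<integral>t. k t * h t \<partial>L)"
    unfolding mean[symmetric]
    using reverse_Hoelder_ratio_bounds[OF ab mM _ _ pos lower upper]
      integrable_prop_hadamard_weight[OF assms(11)] integrable_prop_hadamard_weight[OF assms(12)]
    by (simp add: k_def L_def)
  then show ?thesis
    by (simp add: prop_hadamard_eq_weighted_integral k_def L_def h_def a_def b_def)
qed

end
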